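(* Let $\Bbbk$ be a field and $0\ne v\in\Bbbk$ with $[n]!\ne0$ in $\Bbbk$. Let $\alpha,\beta$ be $1$-factors of the same length, which is at most $n$, each with $m$ pairings. Then $$\langle\eta(\alpha),\mu(\beta)\rangle=\begin{cases}v^m\prod_{j=1}^m[s'_j]&\text{if }\beta\text{ is }\alpha\text{-compatible},\\0&\text{otherwise,}\end{cases}$$ where $s'_j=s'_j(\alpha,\beta)$.
   Context: Quantum integers: for $k\ge0$, $[k]=\sum_{t=0}^{k-1}v^{k-1-2t}\in\Bbbk$, $[-k]=-[k]$, $[k]!=[1][2]\cdots[k]$, $[0]!=1$. $V$ is the two-dimensional space with basis $y_1,y_{-1}$ and operators $Fy_1=y_{-1}$, $Fy_{-1}=0$, $Ky_{\pm1}=v^{\pm1}y_{\pm1}$. On $V^{\otimes m}$, $F$ acts as $\sum_{j=1}^m1^{\otimes(j-1)}\otimes F\otimes(K^{-1})^{\otimes(m-j)}$; $y_{i_1}\otimes\cdots\otimes y_{i_m}$ ($i_j\in\{\pm1\}$) has weight $\sum_ji_j$. ($V^{\otimes0}=\Bbbk$, of weight $0$, with $F=0$.) $\langle-,-\rangle$ is the symmetric bilinear form on $V^{\otimes m}$ for which the $y_{i_1}\otimes\cdots\otimes y_{i_m}$ are orthonormal. For $b\in V^{\otimes(m-1)}$ of weight $i_b$, $\Phi_1(b)=b\otimes y_1$ and $\Phi_2(b)=[i_b]\,b\otimes y_{-1}-v^{i_b}Fb\otimes y_1$. A $1$-factor of length $l$ is a sequence $\alpha=(\alpha_1,\dots,\alpha_l)$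 with $\alpha_i=\pm1$ and all partial sums $\alpha_1+\cdots+\alpha_i\ge0$. If $\alpha_i=1$ and $j$ is the smallest index with $i<j\le l$ and $\alpha_i+\cdots+\alpha_j=0$, then $(i,j)$ is a pairing of $\alpha$; unpaired indices are called defects. $\mu(\alpha)=\Upsilon_l\cdots\Upsilon_1(1)\in V^{\otimes l}$, where $\Upsilon_i=\Phi_1$ if $\alpha_i=1$ and $\Upsilon_i=\Phi_2$ if $\alpha_i=-1$. $\eta(\alpha)\in V^{\otimes l}$ is the tensor product, in order, of a factor $y_1$ for each defect and of nested links; explicitly: $\eta(\emptyset)=1$; if index $1$ is a defect, $\eta(\alpha)=y_1\otimes\eta(\alpha_2,\dots,\alpha_l)$; if $1$ is paired with $j$, $\eta(\alpha)=\Psi(\eta(\alpha_2,\dots,\alpha_{j-1}))\otimes\eta(\alpha_{j+1},\dots,\alpha_l)$, where $\Psi(b)=y_1\otimes b\otimes y_{-1}-v\,y_{-1}\otimes b\otimes y_1$. $\beta$ is $\alpha$-compatible if for every pairing in $\alpha$ the corresponding entries of $\beta$ have opposite signs. Let $i_1<\dots<i_m$ be the positions of the $-1$ entries of $\beta$, and $s_j=s_j(\beta)=\beta_1+\cdots+\beta_{i_j-1}$. Define $s'_j(\alpha,\beta)=-s_j$ if $\alpha_{i_j}=1$ and $s'_j(\alpha,\beta)=s_j+1$ if $\alpha_{i_j}=-1$. *)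

theory Defs
  imports Complex_Main
begin

definition qnat :: "'k::field \<Rightarrow> nat \<Rightarrow> 'k" where
  "qnat v k = (\<Sum>t<k. v powi (int k - 1 - 2 * int t))"

definition qint :: "'k::field \<Rightarrow> int \<Rightarrow> 'k" where
  "qint v k = (if k \<ge> 0 then qnat v (nat k) else - qnat v (nat (- k)))"

definition qfact :: "'k::field \<Rightarrow> nat \<Rightarrow> 'k" where
  "qfact v n = (\<Prod>k=1..n. qnat v k)"

(* A vector is given by its coordinates: x w is the coefficient of
   y_{w!0} \<otimes> ... \<otimes> y_{w!(m-1)}, where w is a word in {1,-1} of length m.  The m-th tensor
   power of V thus consists of the functions supported on words m; the empty word spans
   the 0-th power, that is, the ground field. *)

type_synonym 'k vec = "int list \<Rightarrow> 'k"

definition words :: "nat \<Rightarrow> int list set" where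
  "words m = {w. length w = m \<and> set w \<subseteq> {1, -1}}"

definition basis_vec :: "int list \<Rightarrow> 'k::field vec" where
  "basis_vec u = (\<lambda>w. if w = u then 1 else 0)"

abbreviation yv :: "int \<Rightarrow> 'k::field vec" where
  "yv i \<equiv> basis_vec [i]"

(* For x supported on words of length p only the summand k = p contributes. *)
definition tens :: "'k::field vec \<Rightarrow> 'k vec \<Rightarrow> 'k vec"  (infixl "\<otimes>" 70) where
  "x \<otimes> z = (\<lambda>w. \<Sum>k\<le>length w. x (take k w) * z (drop k w))"

(* Operators on V as matrices: op i k is the coefficient of y_i in the image of y_k. *)
definition op_id :: "int \<Rightarrow> int \<Rightarrow> 'k::field" where
  "op_id i k = (if i = k then 1 else 0)"

definition op_F :: "int \<Rightarrow> int \<Rightarrow> 'k::field" where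
  "op_F i k = (if k = 1 \<and> i = -1 then 1 else 0)"

definition op_Kinv :: "'k \<Rightarrow> int \<Rightarrow> int \<Rightarrow> 'k::field" where
  "op_Kinv v i k = (if i = k then v powi (- k) else 0)"

(* The sum over j of the operators 1 \<otimes> ... \<otimes> 1 \<otimes> F \<otimes> K^{-1} \<otimes> ... \<otimes> K^{-1} with F in position j,
   on every tensor power at once: the degree is the length of u. *)
definition F_act :: "'k::field \<Rightarrow> 'k vec \<Rightarrow> 'k vec" where
  "F_act v x = (\<lambda>u. \<Sum>w\<in>words (length u). (\<Sum>j<length u. \<Prod>p<length u.
      (if p < j then op_id else if p = j then op_F else op_Kinv v) (u ! p) (w ! p)) * x w)"

definition has_weight :: "int \<Rightarrow> 'k::field vec \<Rightarrow> bool" where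
  "has_weight i b \<longleftrightarrow> (\<forall>w. b w \<noteq> 0 \<longrightarrow> sum_list w = i)"

(* Determined by b unless b = 0, in which case Phi2 b = 0 whatever the choice. *)
definition weight :: "'k::field vec \<Rightarrow> int" where
  "weight b = (SOME i. has_weight i b)"

definition form :: "nat \<Rightarrow> 'k::field vec \<Rightarrow> 'k vec \<Rightarrow> 'k" where
  "form m x z = (\<Sum>w\<in>words m. x w * z w)"

definition Phi1 :: "'k::field vec \<Rightarrow> 'k vec" where
  "Phi1 b = b \<otimes> yv 1"

definition Phi2 :: "'k::field \<Rightarrow> 'k vec \<Rightarrow> 'k vec" where
  "Phi2 v b = (\<lambda>w. qint v (weight b) * (b \<otimes> yv (-1)) w
                 - v powi (weight b) * (F_act v b \<otimes> yv 1) w)"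

lemma Phi2_eq:
  assumes "has_weight i b"
  shows "Phi2 v b = (\<lambda>w. qint v i * (b \<otimes> yv (-1)) w - v powi i * (F_act v b \<otimes> yv 1) w)"
proof (cases "\<exists>w. b w \<noteq> 0")
  case True
  have "has_weight (weight b) b"
    unfolding weight_def using assms by (rule someI)
  with True assms have "weight b = i"
    by (auto simp: has_weight_def)
  then show ?thesis by (simp add: Phi2_def)
next
  case False
  then show ?thesis by (simp add: Phi2_def tens_def F_act_def)
qed

(* Entries are indexed from 0. *)
definition one_factor :: "int list \<Rightarrow> bool" where
  "one_factor \<alpha> \<longleftrightarrow> set \<alpha> \<subseteq> {1, -1} \<and> (\<forall>i\<le>length \<alpha>. sum_list (take i \<alpha>) \<ge> 0)"

definition pairings :: "int list \<Rightarrow> (nat \<times> nat) set" where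
  "pairings \<alpha> = {(i, j). i < j \<and> j < length \<alpha> \<and> \<alpha> ! i = 1 \<and> (\<Sum>k=i..j. \<alpha> ! k) = 0
                   \<and> (\<forall>j'. i < j' \<and> j' < j \<longrightarrow> (\<Sum>k=i..j'. \<alpha> ! k) \<noteq> 0)}"

definition mu :: "'k::field \<Rightarrow> int list \<Rightarrow> 'k vec" where
  "mu v \<alpha> = fold (\<lambda>a b. if a = 1 then Phi1 b else Phi2 v b) \<alpha> (basis_vec [])"

definition Psi :: "'k::field \<Rightarrow> 'k vec \<Rightarrow> 'k vec" where
  "Psi v b = (\<lambda>w. (yv 1 \<otimes> b \<otimes> yv (-1)) w - v * (yv (-1) \<otimes> b \<otimes> yv 1) w)"

(* In a 1-factor the first entry is 1, so index 0 is a defect unless it opens a pairing. *)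
function eta :: "'k::field \<Rightarrow> int list \<Rightarrow> 'k vec" where
  "eta v [] = basis_vec []"
| "eta v (a # as) =
    (if \<exists>j. (0, j) \<in> pairings (a # as)
     then let j = (THE j. (0, j) \<in> pairings (a # as))
          in Psi v (eta v (take (j - 1) as)) \<otimes> eta v (drop j as)
     else yv 1 \<otimes> eta v as)"
  by pat_completeness auto
termination
  by (relation "measure (\<lambda>(v, as). length as)") auto

definition compatible :: "int list \<Rightarrow> int list \<Rightarrow> bool" where
  "compatible \<alpha> \<beta> \<longleftrightarrow> (\<forall>(i, j)\<in>pairings \<alpha>. \<beta> ! i = - \<beta> ! j)"

definition neg_positions :: "int list \<Rightarrow> nat list" where
  "neg_positions \<beta> = filter (\<lambda>i. \<beta> ! i = -1) [0..<length \<beta>]"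

definition s_val :: "int list \<Rightarrow> nat \<Rightarrow> int" where
  "s_val \<beta> j = sum_list (take (neg_positions \<beta> ! j) \<beta>)"

definition s_prime :: "int list \<Rightarrow> int list \<Rightarrow> nat \<Rightarrow> int" where
  "s_prime \<alpha> \<beta> j = (if \<alpha> ! (neg_positions \<beta> ! j) = 1 then - s_val \<beta> j else s_val \<beta> j + 1)"

end

theory Submission
  imports Defs
begin

text \<open>
  The idea is to contract \<open>\<alpha>\<close> one innermost pairing at a time.  Such a pairing occupies two
  neighbouring positions: \<open>\<alpha> = x @ 1 # -1 # y\<close>.  The vector \<open>eta v \<alpha>\<close> arises from
  \<open>eta v (x @ y)\<close> by inserting the invariant vector \<open>y\<^sub>1 \<otimes> y\<^sub>-\<^sub>1 - v y\<^sub>-\<^sub>1 \<otimes> y\<^sub>1\<close> after the first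
  \<open>length x\<close> tensor factors (\<open>eta_insert\<close>).  Pairing with \<open>eta v \<alpha>\<close> is therefore the same as first
  contracting the two factors by the adjoint map \<open>cap\<close> and then pairing with \<open>eta v (x @ y)\<close>
  (\<open>form_eta_insert\<close>).

  The contraction of \<open>mu v \<beta>\<close> can be computed because \<open>cap\<close> is a homomorphism: it commutes with
  \<open>F\<close> and preserves weights, hence it commutes with every \<open>Phi1\<close> and \<open>Phi2\<close> that acts to the right
  of the contracted factors.  So only the two operators that create these factors matter.
  Write \<open>\<beta> = \<gamma> @ b1 # b2 # \<delta>\<close> and let \<open>a\<close> be the weight of \<open>mu v \<gamma>\<close>.  The identity
  \<open>v [a] = v\<^sup>a + [a - 1]\<close> yields \<open>0\<close> if \<open>b1 = b2\<close>, the factor \<open>v [a + 2]\<close> for \<open>1, -1\<close> and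
  \<open>v [- a]\<close> for \<open>-1, 1\<close>, times \<open>mu v (\<gamma> @ \<delta>)\<close> (\<open>cap_mu\<close>).  In the last two cases this is
  precisely \<open>v [s']\<close> for the entry \<open>-1\<close> among \<open>b1, b2\<close>, and the remaining \<open>s'\<close> do not change when
  the two positions are deleted, since the deleted entries of \<open>\<beta>\<close> sum to \<open>0\<close>.

  The proof is an induction that deletes neighbours \<open>1, -1\<close> from \<open>\<alpha>\<close> until only defects remain.
  Pairings of \<open>\<alpha>\<close> and of the shortened word correspond (\<open>pairings_insert\<close>), which takes care of
  compatibility and of the number of pairings.  At the end \<open>\<alpha>\<close> consists of entries \<open>1\<close> only;
  since \<open>\<beta>\<close> always has as many entries \<open>-1\<close> as \<open>\<alpha>\<close>, so does \<open>\<beta>\<close>, and both vectors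
  are the same basis vector.
\<close>

section \<open>Vectors of a fixed degree\<close>

text \<open>A coordinate function stands for a vector of the \<open>n\<close>-th tensor power only if it vanishes
  off the words of length \<open>n\<close>; equality of such vectors can then be tested on words.\<close>

definition supported :: "nat \<Rightarrow> 'k::field vec \<Rightarrow> bool" where
  "supported n x \<longleftrightarrow> (\<forall>w. x w \<noteq> 0 \<longrightarrow> w \<in> words n)"

lemma words_0 [simp]: "words 0 = {[]}"
  by (auto simp: words_def)

lemma finite_words [simp]: "finite (words n)"
  using finite_lists_length_eq[of "{1, -1::int}" n] by (simp add: words_def conj_commute)

lemma length_words: "w \<in> words n \<Longrightarrow> length w = n"
  by (simp add: words_def)

lemma snoc_in_words [simp]: "w @ [c] \<in> words (Suc n) \<longleftrightarrow> w \<in> words n \<and> (c = 1 \<or> c = -1)"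
  by (auto simp: words_def)

lemma append_in_words: "u \<in> words a \<Longrightarrow> w \<in> words b \<Longrightarrow> u @ w \<in> words (a + b)"
  by (auto simp: words_def)

lemma words_SucE:
  assumes "w \<in> words (Suc n)"
  obtains u c where "w = u @ [c]" "u \<in> words n" "c = 1 \<or> c = -1"
proof -
  have "w \<noteq> []" using assms by (auto simp: words_def)
  then have "w = butlast w @ [last w]" by simp
  with assms that show thesis by (metis snoc_in_words)
qed

lemma sum_words_Suc:
  "(\<Sum>w\<in>words (Suc n). g w) = (\<Sum>u\<in>words n. g (u @ [1]) + g (u @ [-1]))"
proof -
  have *: "words (Suc n) = (\<lambda>u. u @ [1]) ` words n \<union> (\<lambda>u. u @ [-1]) ` words n"
    by (auto elim: words_SucE)
  show ?thesis
    unfolding * by (subst sum.union_disjoint) (auto simp: sum.reindex inj_on_def sum.distrib)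
qed

lemma supportedD: "supported n x \<Longrightarrow> w \<notin> words n \<Longrightarrow> x w = 0"
  by (auto simp: supported_def)

lemma supported_length: "supported n x \<Longrightarrow> length w \<noteq> n \<Longrightarrow> x w = 0"
  by (auto simp: supported_def words_def)

lemma supported_eqI:
  assumes "supported n x" "supported n z" "\<And>w. w \<in> words n \<Longrightarrow> x w = z w"
  shows "x = z"
proof
  fix w show "x w = z w"
    using assms by (cases "w \<in> words n") (auto simp: supportedD)
qed

lemma supported_basis_vec: "u \<in> words n \<Longrightarrow> supported n (basis_vec u)"
  by (simp add: supported_def basis_vec_def)

lemma tens_eval:
  assumes "supported n x"
  shows "(x \<otimes> z) w = (if n \<le> length w then x (take n w) * z (drop n w) else 0)"
proof -
  have "(x \<otimes> z) w = (\<Sum>k\<le>length w. if k = n then x (take n w) * z (drop n w) else 0)"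
    unfolding tens_def by (rule sum.cong) (auto simp: supported_length[OF assms])
  then show ?thesis by simp
qed

lemma tens_append: "supported (length u) x \<Longrightarrow> (x \<otimes> z) (u @ w) = x u * z w"
  by (simp add: tens_eval)

lemma supported_tens:
  assumes "supported a x" "supported b z"
  shows "supported (a + b) (x \<otimes> z)"
  unfolding supported_def
proof (intro allI impI)
  fix w assume "(x \<otimes> z) w \<noteq> 0"
  then have "x (take a w) \<noteq> 0" "z (drop a w) \<noteq> 0"
    by (auto simp: tens_eval[OF assms(1)] split: if_splits)
  then have "take a w @ drop a w \<in> words (a + b)"
    using assms by (intro append_in_words) (auto simp: supported_def)
  then show "w \<in> words (a + b)" by simp
qed

lemma tens_yv_snoc: "(b \<otimes> yv i) (w @ [c]) = (if c = i then b w else 0)"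
proof -
  have "(b \<otimes> yv i) (w @ [c])
      = (\<Sum>k\<le>length (w @ [c]). if k = length w then (if c = i then b w else 0) else 0)"
    unfolding tens_def
  proof (rule sum.cong)
    fix k assume "k \<in> {..length (w @ [c])}"
    show "b (take k (w @ [c])) * yv i (drop k (w @ [c]))
        = (if k = length w then (if c = i then b w else 0) else 0)"
    proof (cases "k = length w")
      case False
      then have "length (drop k (w @ [c])) \<noteq> 1" by simp
      then have "drop k (w @ [c]) \<noteq> [i]" by (metis length_Cons list.size(3) One_nat_def)
      with False show ?thesis by (simp add: basis_vec_def)
    qed (simp add: basis_vec_def)
  qed simp
  then show ?thesis by (simp del: sum.atMost_Suc)
qed

section \<open>The action of F\<close>

lemma supported_F:
  assumes "supported n x" shows "supported n (F_act v x)"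
  unfolding supported_def
proof (intro allI impI)
  fix u assume "F_act v x u \<noteq> 0"
  then obtain w where w: "w \<in> words (length u)" and nz:
    "(\<Sum>j<length u. \<Prod>p<length u.
      (if p < j then op_id else if p = j then op_F else op_Kinv v) (u ! p) (w ! p)) * x w \<noteq> 0"
    unfolding F_act_def by (rule sum.not_neutral_contains_not_neutral)
  from nz w assms have n: "n = length u" by (auto simp: supported_def words_def)
  from nz have "(\<Sum>j<length u. \<Prod>p<length u.
      (if p < j then op_id else if p = j then op_F else op_Kinv v) (u ! p) (w ! p)) \<noteq> 0"
    by (rule contrapos_nn) simp
  then obtain j where "(\<Prod>p<length u.
      (if p < j then op_id else if p = j then op_F else op_Kinv v) (u ! p) (w ! p)) \<noteq> 0"
    by (rule sum.not_neutral_contains_not_neutral)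
  then have j: "(if p < j then op_id else if p = j then op_F else op_Kinv v) (u ! p) (w ! p) \<noteq> 0"
    if "p < length u" for p
    using that by auto
  have "u ! p = 1 \<or> u ! p = -1" if "p < length u" for p
  proof -
    have "w ! p \<in> {1, -1}" using w nth_mem[of p w] that by (auto simp: words_def simp del: nth_mem)
    then show ?thesis using j[OF that]
      by (auto simp: op_id_def op_F_def op_Kinv_def split: if_splits)
  qed
  then show "u \<in> words n" unfolding words_def set_conv_nth n by blast
qed

lemma F_Nil [simp]: "F_act v x [] = 0"
  by (simp add: F_act_def)

lemma F_linear:
  "F_act v (\<lambda>w. a * x w + b * z w) = (\<lambda>u. a * F_act v x u + b * F_act v z u)"
  by (simp add: F_act_def sum_distrib_left sum.distrib algebra_simps)

lemma prod_op_id: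
  assumes "length w = length u"
  shows "(\<Prod>p<length u. op_id (u ! p) (w ! p)) = (if w = u then 1 else 0 :: 'k::field)"
proof (cases "w = u")
  case False
  then obtain p where "p < length u" "u ! p \<noteq> w ! p"
    using assms by (metis nth_equalityI)
  then have "(\<Prod>p<length u. op_id (u ! p) (w ! p) :: 'k) = 0"
    by (intro prod_zero) (auto simp: op_id_def)
  with False show ?thesis by simp
qed (simp add: op_id_def)

text \<open>The coproduct, read off the last tensor factor: in \<open>1 \<otimes> F + F \<otimes> K\<^sup>-\<^sup>1\<close> the first summand
  contributes only to the last letter \<open>-1\<close>.  This recursion replaces the explicit matrix of
  \<open>F\<close> from here on.\<close>

lemma F_snoc:
  assumes "u \<in> words n"
  shows "F_act v x (u @ [1]) = inverse v * F_act v (\<lambda>w. x (w @ [1])) u"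
    and "F_act v x (u @ [-1]) = x (u @ [1]) + v * F_act v (\<lambda>w. x (w @ [-1])) u"
proof -
  \<comment> \<open>\<open>?M k u w j\<close> is the matrix entry of the \<open>j\<close>-th summand of \<open>F\<close> on the first \<open>k\<close> factors.\<close>
  let ?M = "\<lambda>k u w j. \<Prod>p<k.
      (if p < j then op_id else if p = j then op_F else op_Kinv v) (u ! p) (w ! p)"
  have n: "length u = n" using assms by (simp add: words_def)
  have M: "(\<Sum>j<Suc n. ?M (Suc n) (u @ [c]) (w @ [d]) j)
      = op_Kinv v c d * (\<Sum>j<n. ?M n u w j) + op_F c d * (if w = u then 1 else 0)"
    if "w \<in> words n" for w c d
  proof -
    have lw: "length w = n" using that by (simp add: words_def)
    have "?M (Suc n) (u @ [c]) (w @ [d]) n = (\<Prod>p<length u. op_id (u ! p) (w ! p)) * op_F c d"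
      using n lw by (auto simp: nth_append intro!: prod.cong)
    then have "?M (Suc n) (u @ [c]) (w @ [d]) n = op_F c d * (if w = u then 1 else 0)"
      using prod_op_id[of w u, where ?'k = 'a] lw n by (simp only: mult.commute)
    moreover have "?M (Suc n) (u @ [c]) (w @ [d]) j = op_Kinv v c d * ?M n u w j" if "j < n" for j
      using n lw that by (auto simp: nth_append intro!: prod.cong)
    then have "(\<Sum>j<n. ?M (Suc n) (u @ [c]) (w @ [d]) j) = (\<Sum>j<n. op_Kinv v c d * ?M n u w j)"
      by (intro sum.cong) (simp_all only: lessThan_iff)
    ultimately show ?thesis
      by (simp only: sum.lessThan_Suc sum_distrib_left)
  qed
  define S where "S = (\<lambda>w. \<Sum>j<n. ?M n u w j)"
  have F': "F_act v z u = (\<Sum>w\<in>words n. S w * z w)" for z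
    unfolding F_act_def n S_def ..
  have F: "F_act v x (u @ [c]) =
      (\<Sum>w\<in>words n. (op_Kinv v c 1 * S w + op_F c 1 * (if w = u then 1 else 0)) * x (w @ [1])
        + (op_Kinv v c (-1) * S w + op_F c (-1) * (if w = u then 1 else 0)) * x (w @ [-1]))" for c
    unfolding F_act_def length_append_singleton n sum_words_Suc S_def
    by (rule sum.cong) (simp_all only: M)
  show "F_act v x (u @ [1]) = inverse v * F_act v (\<lambda>w. x (w @ [1])) u"
    unfolding F F' sum_distrib_left
    by (rule sum.cong) (simp_all add: op_Kinv_def op_F_def power_int_minus mult.assoc)
  have "F_act v x (u @ [-1])
      = (\<Sum>w\<in>words n. (if w = u then x (u @ [1]) else 0) + v * (S w * x (w @ [-1])))"
    unfolding F by (rule sum.cong) (auto simp: op_Kinv_def op_F_def)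
  then show "F_act v x (u @ [-1]) = x (u @ [1]) + v * F_act v (\<lambda>w. x (w @ [-1])) u"
    using assms unfolding F' sum.distrib sum_distrib_left by simp
qed

lemma has_weight_F:
  assumes "supported n x" "has_weight i x"
  shows "has_weight (i - 2) (F_act v x)"
proof -
  have "\<lbrakk>u \<in> words n; has_weight i x; F_act v x u \<noteq> 0\<rbrakk> \<Longrightarrow> sum_list u = i - 2" for u
  proof (induction u arbitrary: n i x rule: rev_induct)
    case (snoc c u)
    then obtain k where k: "n = Suc k" by (auto simp: words_def)
    have u: "u \<in> words k" and c: "c = 1 \<or> c = -1" using snoc.prems k by auto
    have sl: "has_weight (i - a) (\<lambda>w. x (w @ [a]))" for a
      using snoc.prems(2) by (fastforce simp: has_weight_def)
    note IH = snoc.IH[OF u sl]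
    from c show ?case
    proof
      assume "c = 1" with IH[of 1] snoc.prems(3) F_snoc[OF u, of v x] show ?thesis by simp
    next
      assume c: "c = -1"
      show ?thesis
      proof (cases "x (u @ [1]) = 0")
        case True with c IH[of "-1"] snoc.prems(3) F_snoc[OF u, of v x] show ?thesis by simp
      next
        case False then have "sum_list (u @ [1]) = i"
          using snoc.prems(2) by (auto simp: has_weight_def)
        with c show ?thesis by simp
      qed
    qed
  qed simp
  then show ?thesis using assms supported_F[OF assms(1), of v]
    by (auto simp: has_weight_def supported_def)
qed

section \<open>The vectors mu\<close>

lemma Phi1_snoc: "Phi1 b (w @ [c]) = (if c = 1 then b w else 0)"
  by (simp add: Phi1_def tens_yv_snoc)

lemma Phi2_snoc:
  assumes "has_weight i b"
  shows "Phi2 v b (w @ [c]) = (if c = 1 then - (v powi i * F_act v b w)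
           else if c = -1 then qint v i * b w else 0)"
  by (simp add: Phi2_eq[OF assms] tens_yv_snoc)

lemma supported_Phi1: "supported n b \<Longrightarrow> supported (Suc n) (Phi1 b)"
  using supported_tens[of n b 1 "yv 1"] supported_basis_vec[of "[1]" 1]
  by (simp add: Phi1_def words_def)

lemma supported_Phi2:
  assumes "supported n b" shows "supported (Suc n) (Phi2 v b)"
proof -
  have "supported (n + 1) (b \<otimes> yv (-1))" "supported (n + 1) (F_act v b \<otimes> yv 1)"
    using assms by (intro supported_tens supported_basis_vec supported_F; simp add: words_def)+
  then show ?thesis
    unfolding Phi2_def supported_def by (metis Suc_eq_plus1 diff_zero mult_zero_right)
qed

lemma mu_snoc: "mu v (\<beta> @ [c]) = (if c = 1 then Phi1 (mu v \<beta>) else Phi2 v (mu v \<beta>))"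
  by (simp add: mu_def)

lemma mu_Nil: "mu v [] = basis_vec []"
  by (simp add: mu_def)

lemma supported_mu: "supported (length \<beta>) (mu v \<beta>)"
  by (induction \<beta> rule: rev_induct)
    (auto simp: mu_snoc mu_Nil supported_Phi1 supported_Phi2 supported_basis_vec)

lemma has_weightI:
  assumes "supported (Suc n) x" "\<And>u c. u \<in> words n \<Longrightarrow> c = 1 \<or> c = -1 \<Longrightarrow> x (u @ [c]) \<noteq> 0
      \<Longrightarrow> sum_list u + c = i"
  shows "has_weight i x"
  unfolding has_weight_def
proof (intro allI impI)
  fix w assume nz: "x w \<noteq> 0"
  then have "w \<in> words (Suc n)" using assms(1) by (auto simp: supported_def)
  then obtain u c where "w = u @ [c]" "u \<in> words n" "c = 1 \<or> c = -1" by (elim words_SucE)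
  with assms(2) nz show "sum_list w = i" by simp
qed

lemma has_weight_Phi1:
  assumes "supported n b" "has_weight i b" shows "has_weight (i + 1) (Phi1 b)"
  by (rule has_weightI[OF supported_Phi1[OF assms(1)]])
     (use assms(2) in \<open>auto simp: Phi1_snoc has_weight_def split: if_splits\<close>)

lemma has_weight_Phi2:
  assumes "supported n b" "has_weight i b" shows "has_weight (i - 1) (Phi2 v b)"
  by (rule has_weightI[OF supported_Phi2[OF assms(1)]])
     (use assms(2) has_weight_F[OF assms, of v] in
       \<open>auto simp: Phi2_snoc[OF assms(2)] has_weight_def split: if_splits\<close>)

lemma has_weight_mu: "set \<beta> \<subseteq> {1, -1} \<Longrightarrow> has_weight (sum_list \<beta>) (mu v \<beta>)"
proof (induction \<beta> rule: rev_induct)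
  case Nil then show ?case by (simp add: mu_Nil has_weight_def basis_vec_def)
next
  case (snoc c \<beta>)
  then have b: "has_weight (sum_list \<beta>) (mu v \<beta>)" and c: "c = 1 \<or> c = -1" by auto
  show ?case
    using c has_weight_Phi1[OF supported_mu b] has_weight_Phi2[OF supported_mu b]
    by (auto simp: mu_snoc)
qed

section \<open>Contraction of two neighbouring tensor factors\<close>

text \<open>The adjoint of inserting \<open>y\<^sub>1 \<otimes> y\<^sub>-\<^sub>1 - v y\<^sub>-\<^sub>1 \<otimes> y\<^sub>1\<close> after the first \<open>p\<close> factors.  On words
  with fewer than \<open>p\<close> letters its value is meaningless, but it is \<open>0\<close> as soon as \<open>x\<close> is supported
  in a degree \<open>n + 2\<close> with \<open>p \<le> n\<close>.\<close>

definition cap :: "'k::field \<Rightarrow> nat \<Rightarrow> 'k vec \<Rightarrow> 'k vec" where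
  "cap v p x = (\<lambda>w. x (take p w @ [1, -1] @ drop p w) - v * x (take p w @ [-1, 1] @ drop p w))"

lemma cap_snoc:
  "p \<le> length u \<Longrightarrow> cap v p x (u @ [c]) = x ((take p u @ [1, -1] @ drop p u) @ [c])
      - v * x ((take p u @ [-1, 1] @ drop p u) @ [c])"
  by (simp add: cap_def)

lemma supported_cap:
  assumes "supported (n + 2) x" shows "supported n (cap v p x)"
  unfolding supported_def
proof (intro allI impI)
  fix w assume "cap v p x w \<noteq> 0"
  then have "take p w @ [1, -1] @ drop p w \<in> words (n + 2)
      \<or> take p w @ [-1, 1] @ drop p w \<in> words (n + 2)"
    unfolding cap_def using supportedD[OF assms] by (metis diff_zero mult_zero_right)
  then have "set (take p w @ drop p w) \<subseteq> {1, -1} \<and> length w = n"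
    unfolding words_def set_append by auto
  then show "w \<in> words n" by (simp add: words_def)
qed

lemma has_weight_cap: assumes "has_weight i x" shows "has_weight i (cap v p x)"
  unfolding has_weight_def
proof (intro allI impI)
  fix w assume "cap v p x w \<noteq> 0"
  then have "sum_list (take p w @ [1, -1] @ drop p w) = i
      \<or> sum_list (take p w @ [-1, 1] @ drop p w) = i"
    using assms unfolding cap_def has_weight_def by (metis diff_zero mult_zero_right)
  then have "sum_list (take p w @ drop p w) = i"
    unfolding sum_list_append by simp
  then show "sum_list w = i" by simp
qed

text \<open>The two contracted factors carry the trivial representation: \<open>K\<close> acts by \<open>1\<close> on the weight
  space \<open>0\<close>, so \<open>F\<close> passes the contracted factors unchanged, and the contraction kills
  \<open>F (y\<^sub>1 \<otimes> y\<^sub>1) = y\<^sub>1 \<otimes> y\<^sub>-\<^sub>1 + v\<^sup>-\<^sup>1 y\<^sub>-\<^sub>1 \<otimes> y\<^sub>1\<close>, because \<open>1 - v v\<^sup>-\<^sup>1 = 0\<close>.  The induction is on the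
  number of factors to the right of the contracted ones; its base case is that computation.\<close>

lemma cap_F:
  assumes "v \<noteq> 0" "supported (n + 2) x" "p \<le> n"
  shows "cap v p (F_act v x) = F_act v (cap v p x)"
  using assms(2,3)
proof (induction "n - p" arbitrary: n x)
  case 0
  then have p: "p = n" by simp
  show ?case
  proof (rule supported_eqI)
    show "supported n (cap v p (F_act v x))" "supported n (F_act v (cap v p x))"
      using 0 by (auto intro!: supported_cap supported_F)
    fix w assume w: "w \<in> words n"
    \<comment> \<open>The terms \<open>x (w @ [1, 1])\<close> in the next two equations cancel in the contraction.\<close>
    then have w': "w @ [c] \<in> words (Suc n)" if "c = 1 \<or> c = -1" for c
      using that by auto
    have lw: "length w = n" using w by (simp add: words_def)
    have "F_act v x (w @ [1, -1]) = x (w @ [1, 1]) + F_act v (\<lambda>u. x (u @ [1, -1])) w"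
      using F_snoc(2)[OF w'[of 1], of v x] F_snoc(1)[OF w, of v "\<lambda>u. x (u @ [-1])"] assms(1)
      by simp
    moreover have "v * F_act v x (w @ [-1, 1])
        = x (w @ [1, 1]) + v * F_act v (\<lambda>u. x (u @ [-1, 1])) w"
      using F_snoc(1)[OF w'[of "-1"], of v x] F_snoc(2)[OF w, of v "\<lambda>u. x (u @ [1])"] assms(1)
      by simp
    moreover have "F_act v (cap v p x) w
        = F_act v (\<lambda>u. 1 * x (u @ [1, -1]) + (- v) * x (u @ [-1, 1])) w"
      unfolding F_act_def
      by (rule sum.cong) (auto simp: lw p words_def cap_def)
    ultimately show "cap v p (F_act v x) w = F_act v (cap v p x) w"
      unfolding F_linear using lw p by (simp add: cap_def)
  qed
next
  case (Suc d)
  then obtain k where k: "n = Suc k" "d = k - p" "p \<le> k" by (cases n) auto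
  have sl: "supported (k + 2) (\<lambda>w. x (w @ [a]))" for a
    using Suc.prems(1) k(1) by (fastforce simp: supported_def)
  have cap_sl: "(\<lambda>w. cap v p x (w @ [a])) = cap v p (\<lambda>w. x (w @ [a]))" for a
  proof
    fix w
    show "cap v p x (w @ [a]) = cap v p (\<lambda>w. x (w @ [a])) w"
    proof (cases "p \<le> length w")
      case True then show ?thesis by (simp add: cap_def)
    next
      case False
      then have "length (w @ [a]) \<noteq> n" "length w \<noteq> k" using k by auto
      then have "cap v p x (w @ [a]) = 0" "cap v p (\<lambda>w. x (w @ [a])) w = 0"
        by (simp_all only: supported_length[OF supported_cap[OF Suc.prems(1)]]
            supported_length[OF supported_cap[OF sl]] simp_thms)
      then show ?thesis by simp
    qed
  qed
  have IH: "cap v p (F_act v (\<lambda>w. x (w @ [a]))) = F_act v (\<lambda>w. cap v p x (w @ [a]))" for a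
    unfolding cap_sl using Suc.hyps(1)[OF k(2) sl k(3)] .
  show ?case
  proof (rule supported_eqI)
    show "supported n (cap v p (F_act v x))" "supported n (F_act v (cap v p x))"
      using Suc.prems by (auto intro!: supported_cap supported_F)
    fix w assume "w \<in> words n"
    then obtain u c where w: "w = u @ [c]" "u \<in> words k" "c = 1 \<or> c = -1"
      unfolding k(1) by (elim words_SucE)
    have lu: "length u = k" using w(2) by (simp add: words_def)
    have ins: "take p u @ [a, b] @ drop p u \<in> words (k + 2)"
      if "a = 1 \<or> a = -1" "b = 1 \<or> b = -1" for a b
    proof -
      have "set u \<subseteq> {1, -1}" using w(2) by (simp add: words_def)
      then have "set (take p u) \<subseteq> {1, -1}" "set (drop p u) \<subseteq> {1, -1}"
        by (meson order_trans set_take_subset set_drop_subset)+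
      then show ?thesis using that lu k(3) by (auto simp: words_def)
    qed
    have pu: "p \<le> length u" using lu k(3) by simp
    from w(3) show "cap v p (F_act v x) w = F_act v (cap v p x) w"
      by (rule disjE; simp only: w(1) cap_snoc[OF pu] F_snoc[OF ins] F_snoc[OF w(2)]
            disj_commute simp_thms flip: IH)
         (simp_all add: cap_def algebra_simps)
  qed
qed

lemma cap_Phi1:
  assumes "supported (n + 2) x" "p \<le> n"
  shows "cap v p (Phi1 x) = Phi1 (cap v p x)"
proof (rule supported_eqI)
  show "supported (Suc n) (cap v p (Phi1 x))" "supported (Suc n) (Phi1 (cap v p x))"
    using supported_Phi1[OF assms(1)] supported_cap[OF assms(1)]
    by (auto intro: supported_cap supported_Phi1)
  fix w assume "w \<in> words (Suc n)"
  then obtain u c where w: "w = u @ [c]" "u \<in> words n" by (elim words_SucE)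
  then show "cap v p (Phi1 x) w = Phi1 (cap v p x) w"
    using assms(2) by (simp only: w(1) cap_snoc Phi1_snoc length_words) (simp add: cap_def)
qed

lemma cap_Phi2:
  assumes "v \<noteq> 0" "supported (n + 2) x" "p \<le> n" "has_weight i x"
  shows "cap v p (Phi2 v x) = Phi2 v (cap v p x)"
proof (rule supported_eqI)
  show "supported (Suc n) (cap v p (Phi2 v x))" "supported (Suc n) (Phi2 v (cap v p x))"
    using supported_Phi2[OF assms(2)] supported_cap[OF assms(2)]
    by (auto intro: supported_cap supported_Phi2)
  fix w assume "w \<in> words (Suc n)"
  then obtain u c where w: "w = u @ [c]" "u \<in> words n" by (elim words_SucE)
  then show "cap v p (Phi2 v x) w = Phi2 v (cap v p x) w"
    using assms(3)
    by (simp only: w(1) cap_snoc length_words Phi2_snoc[OF assms(4)]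
        Phi2_snoc[OF has_weight_cap[OF assms(4)]] flip: cap_F[OF assms(1-3)])
       (simp add: cap_def algebra_simps)
qed

section \<open>Quantum integers\<close>

lemma qnat_Suc: "v \<noteq> 0 \<Longrightarrow> v * qnat v (Suc k) = v powi (int k + 1) + qnat v k"
proof -
  assume v: "v \<noteq> 0"
  have "v * qnat v (Suc k) = (\<Sum>t<Suc k. v powi (int k + 1 - 2 * int t))"
    unfolding qnat_def sum_distrib_left
    by (rule sum.cong) (use v in \<open>simp_all add: power_int_diff power_int_add field_simps\<close>)
  also have "\<dots> = v powi (int k + 1) + qnat v k"
    unfolding sum.lessThan_Suc_shift qnat_def by (simp add: algebra_simps)
  finally show ?thesis .
qed

lemma qnat_Suc_mirror: "v \<noteq> 0 \<Longrightarrow> qnat v (Suc k) = v powi (- int k) + v * qnat v k"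
proof -
  assume v: "v \<noteq> 0"
  have "v * qnat v k = (\<Sum>t<k. v powi (int k - 2 * int t))"
    unfolding qnat_def sum_distrib_left
    by (rule sum.cong) (use v in \<open>simp_all add: power_int_diff power_int_add field_simps\<close>)
  moreover have "qnat v (Suc k) = (\<Sum>t<k. v powi (int k - 2 * int t)) + v powi (- int k)"
    unfolding qnat_def by simp
  ultimately show ?thesis by simp
qed

text \<open>The only property of quantum integers that the contraction uses.  It holds for negative
  integers too, where it is the mirror image of the one for positive integers.\<close>

lemma qint_rec:
  assumes "v \<noteq> 0" shows "v * qint v a = v powi a + qint v (a - 1)"
proof (cases "a \<ge> 1")
  case True
  then obtain k where "a = int k + 1" by (metis add.commute zle_iff_zadd)
  then show ?thesis using qnat_Suc[OF assms, of k] by (simp add: qint_def nat_add_distrib)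
next
  case False
  then have "a \<le> 0" by simp
  then obtain k where a: "a = - int k" by (rule nonpos_int_cases)
  then show ?thesis using qnat_Suc_mirror[OF assms, of k]
    by (cases "k = 0") (simp_all add: qint_def nat_add_distrib qnat_def)
qed

lemma qint_minus: "qint v (- a) = - qint v a"
  by (cases "a = 0") (auto simp: qint_def qnat_def)


section \<open>Contraction of mu\<close>

lemma F_scale: "F_act v (\<lambda>w. c * x w) = (\<lambda>u. c * F_act v x u)"
  using F_linear[of v c x 0 x] by simp

lemma Phi1_scale: "Phi1 (\<lambda>w. c * x w) = (\<lambda>w. c * Phi1 x w)"
  by (simp add: Phi1_def tens_def sum_distrib_left mult.assoc)

lemma Phi2_scale:
  assumes "has_weight i x"
  shows "Phi2 v (\<lambda>w. c * x w) = (\<lambda>w. c * Phi2 v x w)"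
proof -
  have "has_weight i (\<lambda>w. c * x w)" using assms by (auto simp: has_weight_def)
  from Phi2_eq[OF this, of v] show ?thesis
    unfolding Phi2_eq[OF assms] F_scale
    by (simp add: tens_def sum_distrib_left algebra_simps)
qed

text \<open>The core computation, for \<open>b = mu v \<gamma>\<close> of weight \<open>i\<close>.  The contracted pair is the
  last one here, and the four cases are as follows: \<open>Phi1 (Phi1 b)\<close> has no term in \<open>y\<^sub>-\<^sub>1\<close> at the
  last two places; \<open>Phi2 (Phi1 b)\<close> gives \<open>[i+1] + v v\<^sup>i\<^sup>+\<^sup>1\<close>; \<open>Phi1 (Phi2 b)\<close> gives \<open>- v [i]\<close>;
  and for \<open>Phi2 (Phi2 b)\<close> the multiples of \<open>F b\<close> cancel.\<close>

lemma cap_mu_pair: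
  assumes v: "v \<noteq> 0" and \<gamma>: "set \<gamma> \<subseteq> {1, -1}" and b: "b1 = 1 \<or> b1 = -1" "b2 = 1 \<or> b2 = -1"
  shows "cap v (length \<gamma>) (mu v (\<gamma> @ [b1, b2]))
    = (\<lambda>w. (if b1 = b2 then 0
              else v * qint v (if b1 = 1 then sum_list \<gamma> + 2 else - sum_list \<gamma>))
             * mu v \<gamma> w)"
    (is "_ = (\<lambda>w. ?c * _ w)")
proof (rule supported_eqI)
  let ?n = "length \<gamma>" and ?i = "sum_list \<gamma>" and ?b = "mu v \<gamma>"
  show "supported ?n (cap v ?n (mu v (\<gamma> @ [b1, b2])))"
    using supported_mu[of "\<gamma> @ [b1, b2]" v] by (intro supported_cap) simp
  show "supported ?n (\<lambda>w. ?c * ?b w)"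
    using supported_mu[of \<gamma> v] by (auto simp: supported_def)
  fix w assume w: "w \<in> words ?n"
  have supp: "supported ?n ?b" and wt: "has_weight ?i ?b"
    using supported_mu has_weight_mu[OF \<gamma>] by auto
  have wt1: "has_weight (?i + 1) (Phi1 ?b)" and wt2: "has_weight (?i - 1) (Phi2 v ?b)"
    using has_weight_Phi1[OF supp wt] has_weight_Phi2[OF supp wt] by auto
  have cap: "cap v ?n x w = x ((w @ [1]) @ [-1]) - v * x ((w @ [-1]) @ [1])" for x
    using w by (simp add: cap_def length_words)
  have mu2: "mu v (\<gamma> @ [b1, b2]) = mu v ((\<gamma> @ [b1]) @ [b2])" by simp
  have F1: "F_act v (Phi1 ?b) (w @ [-1]) = ?b w"
    unfolding F_snoc[OF w] Phi1_snoc using F_scale[of v 0 ?b] by simp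
  have F2: "F_act v (Phi2 v ?b) (w @ [-1])
      = (v * qint v ?i - v powi ?i) * F_act v ?b w"
    unfolding F_snoc[OF w] Phi2_snoc[OF wt] by (simp add: F_scale) (simp add: algebra_simps)
  have vp: "v * v powi (a - 1) = v powi a" for a
    using v by (simp add: power_int_diff)
  show "cap v ?n (mu v (\<gamma> @ [b1, b2])) w = ?c * ?b w"
    using b
  proof (elim disjE)
    assume b: "b1 = 1" "b2 = 1"
    have "cap v ?n (Phi1 (Phi1 ?b)) w = 0" unfolding cap Phi1_snoc by simp
    then show ?thesis using b unfolding mu2 mu_snoc by simp
  next
    assume b: "b1 = -1" "b2 = 1"
    have "cap v ?n (Phi1 (Phi2 v ?b)) w = v * qint v (- ?i) * ?b w"
      unfolding cap Phi1_snoc Phi2_snoc[OF wt] by (simp add: qint_minus)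
    then show ?thesis using b unfolding mu2 mu_snoc by simp
  next
    assume b: "b1 = 1" "b2 = -1"
    have "cap v ?n (Phi2 v (Phi1 ?b)) w = (qint v (?i + 1) + v * v powi (?i + 1)) * ?b w"
      unfolding cap Phi2_snoc[OF wt1] F1 Phi1_snoc by (simp add: algebra_simps)
    also have "qint v (?i + 1) + v * v powi (?i + 1) = v * qint v (?i + 2)"
      using qint_rec[OF v, of "?i + 2"] vp[of "?i + 2"] by (simp add: add.commute)
    finally show ?thesis using b unfolding mu2 mu_snoc by simp
  next
    assume b: "b1 = -1" "b2 = -1"
    have "cap v ?n (Phi2 v (Phi2 v ?b)) w
        = - qint v (?i - 1) * v powi ?i * F_act v ?b w
          + (v * v powi (?i - 1)) * (v * qint v ?i - v powi ?i) * F_act v ?b w"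
      unfolding cap Phi2_snoc[OF wt2] F2 Phi2_snoc[OF wt] by (simp add: algebra_simps)
    also have "\<dots> = 0" unfolding vp qint_rec[OF v] by (simp add: algebra_simps)
    finally show ?thesis using b unfolding mu2 mu_snoc by simp
  qed
qed

text \<open>The factors to the right of the contracted pair are created by operators that commute with
  the contraction, so the coefficient found for the last pair persists.\<close>

lemma cap_mu:
  assumes v: "v \<noteq> 0" and \<beta>: "set (\<gamma> @ b1 # b2 # \<delta>) \<subseteq> {1, -1}"
  shows "cap v (length \<gamma>) (mu v (\<gamma> @ b1 # b2 # \<delta>))
    = (\<lambda>w. (if b1 = b2 then 0
              else v * qint v (if b1 = 1 then sum_list \<gamma> + 2 else - sum_list \<gamma>))
             * mu v (\<gamma> @ \<delta>) w)"
  using \<beta>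
proof (induction \<delta> rule: rev_induct)
  case Nil
  then show ?case using cap_mu_pair[OF v, of \<gamma> b1 b2] by auto
next
  case (snoc c \<delta>)
  let ?x = "mu v (\<gamma> @ b1 # b2 # \<delta>)"
  have c: "c = 1 \<or> c = -1" using snoc.prems by auto
  have supp: "supported (length (\<gamma> @ \<delta>) + 2) ?x"
    using supported_mu[of "\<gamma> @ b1 # b2 # \<delta>" v] by simp
  have wt: "has_weight (sum_list (\<gamma> @ b1 # b2 # \<delta>)) ?x"
    using snoc.prems by (intro has_weight_mu) auto
  have wt': "has_weight (sum_list (\<gamma> @ \<delta>)) (mu v (\<gamma> @ \<delta>))"
    using snoc.prems by (intro has_weight_mu) auto
  note mu_s = mu_snoc[of v "\<gamma> @ b1 # b2 # \<delta>" c, simplified] mu_snoc[of v "\<gamma> @ \<delta>" c, simplified]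
  have IH: "cap v (length \<gamma>) ?x
    = (\<lambda>w. (if b1 = b2 then 0
              else v * qint v (if b1 = 1 then sum_list \<gamma> + 2 else - sum_list \<gamma>))
             * mu v (\<gamma> @ \<delta>) w)"
    using snoc by simp
  show ?case
    unfolding mu_s using cap_Phi1[OF supp, of "length \<gamma>" v] cap_Phi2[OF v supp _ wt, of "length \<gamma>"]
    unfolding IH Phi1_scale Phi2_scale[OF wt'] by auto
qed

section \<open>Pairings under deletion of two neighbours\<close>

definition height :: "int list \<Rightarrow> nat \<Rightarrow> int" where
  "height \<alpha> k = sum_list (take k \<alpha>)"

lemma height_Suc: "i < length \<alpha> \<Longrightarrow> height \<alpha> (Suc i) = height \<alpha> i + \<alpha> ! i"
  by (simp add: height_def take_Suc_conv_app_nth)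

lemma sum_entries_eq_height_diff:
  assumes "i \<le> j" "j < length \<alpha>"
  shows "(\<Sum>k=i..j. \<alpha> ! k) = height \<alpha> (Suc j) - height \<alpha> i"
proof -
  have "(\<Sum>k=i..j. \<alpha> ! k) = (\<Sum>k=i..j. height \<alpha> (Suc k) - height \<alpha> k)"
    using assms by (intro sum.cong) (auto simp: height_Suc)
  also have "\<dots> = height \<alpha> (Suc j) - height \<alpha> i"
    using assms(1) by (intro sum_Suc_diff) simp
  finally show ?thesis .
qed

text \<open>As heights change by one at each step, a height that starts above its initial value cannot
  get below it without returning to it.  So the partner of \<open>i\<close> is the first return of the height,
  and the height stays strictly above in between.  Unlike the inequations in the definition,
  a strict lower bound on a height passes at once to the next height if the latter is larger.\<close>

lemma pairings_iff_height:
  assumes "set \<alpha> \<subseteq> {1, -1}"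
  shows "(i, j) \<in> pairings \<alpha> \<longleftrightarrow> i < j \<and> j < length \<alpha> \<and> height \<alpha> (Suc j) = height \<alpha> i
     \<and> (\<forall>k. i < k \<and> k \<le> j \<longrightarrow> height \<alpha> i < height \<alpha> k)"
    (is "_ \<longleftrightarrow> ?R")
proof
  assume "(i, j) \<in> pairings \<alpha>"
  then have ij: "i < j" "j < length \<alpha>" "\<alpha> ! i = 1" "height \<alpha> (Suc j) = height \<alpha> i"
    and nz: "\<And>k. i < k \<Longrightarrow> k < j \<Longrightarrow> height \<alpha> (Suc k) \<noteq> height \<alpha> i"
    by (auto simp: pairings_def sum_entries_eq_height_diff)
  have "height \<alpha> i < height \<alpha> k" if "Suc i \<le> k" "k \<le> j" for k
    using that
  proof (induction k rule: dec_induct)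
    case base then show ?case using ij by (simp add: height_Suc)
  next
    case (step k)
    then have k: "i < k" "k < j" "k < length \<alpha>" using ij by auto
    then have "\<alpha> ! k = 1 \<or> \<alpha> ! k = -1" using assms nth_mem[of k \<alpha>] by blast
    then show ?case using step k nz[OF k(1,2)] height_Suc[OF k(3)] by auto
  qed
  with ij show ?R by auto
next
  assume R: ?R
  then have ij: "i < length \<alpha>" by simp
  have "height \<alpha> i < height \<alpha> (Suc i)" using R by auto
  moreover have "\<alpha> ! i = 1 \<or> \<alpha> ! i = -1" using assms nth_mem[OF ij] by blast
  ultimately have "\<alpha> ! i = 1" using height_Suc[OF ij] by auto
  moreover have "height \<alpha> (Suc k) \<noteq> height \<alpha> i" if "i < k" "k < j" for k
  proof -
    have "i < Suc k \<and> Suc k \<le> j" using that by auto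
    with R have "height \<alpha> i < height \<alpha> (Suc k)" by blast
    then show ?thesis by simp
  qed
  ultimately show "(i, j) \<in> pairings \<alpha>"
    using R by (auto simp: pairings_def sum_entries_eq_height_diff)
qed

text \<open>The position in \<open>x @ a # b # y\<close> of the letter number \<open>k\<close> of \<open>x @ y\<close>, where \<open>p = length x\<close>.\<close>

definition skip_pair :: "nat \<Rightarrow> nat \<Rightarrow> nat" where
  "skip_pair p k = (if k < p then k else k + 2)"

lemma height_insert:
  "k \<le> length x \<Longrightarrow> height (x @ a # b # y) k = height (x @ y) k"
  "height (x @ a # b # y) (Suc (length x)) = height (x @ y) (length x) + a"
  "a + b = 0 \<Longrightarrow> length x \<le> k \<Longrightarrow> height (x @ a # b # y) (Suc (Suc k)) = height (x @ y) k"
  by (simp_all add: height_def Suc_diff_le)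

lemma nth_insert: "(x @ a # b # y) ! skip_pair (length x) k = (x @ y) ! k"
  by (auto simp: skip_pair_def nth_append Suc_diff_le)

text \<open>If \<open>S\<close> is the height of \<open>x @ y\<close>, then the insertion adds the heights \<open>S p + 1\<close> and \<open>S p\<close> after
  the height \<open>S p\<close>.  Both lie above \<open>S i\<close> for an old pairing \<open>(i, j)\<close> around the inserted letters,
  because \<open>S i < S p\<close> is already among the conditions for it.\<close>

lemma pairings_insert_skip_pair:
  assumes "set (x @ y) \<subseteq> {1, -1}"
  shows "(skip_pair (length x) i, skip_pair (length x) j) \<in> pairings (x @ 1 # -1 # y)
    \<longleftrightarrow> (i, j) \<in> pairings (x @ y)"
proof -
  define p where "p = length x"
  define S where "S = height (x @ y)"
  define T where "T = height (x @ 1 # -1 # y)"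
  have T: "\<And>k. k \<le> p \<Longrightarrow> T k = S k" "T (Suc p) = S p + 1" "\<And>k. p \<le> k \<Longrightarrow> T (Suc (Suc k)) = S k"
    unfolding S_def T_def p_def by (simp_all add: height_insert)
  have T_skip: "T (skip_pair p k) = S k" "T (Suc (skip_pair p k)) = S (Suc k)" for k
    using T(1)[of k] T(1)[of "Suc k"] T(3)[of k] T(3)[of "Suc k"] by (auto simp: skip_pair_def)
  have "(\<forall>k. skip_pair p i < k \<and> k \<le> skip_pair p j \<longrightarrow> S i < T k)
      \<longleftrightarrow> (\<forall>k. i < k \<and> k \<le> j \<longrightarrow> S i < S k)"
    (is "?L \<longleftrightarrow> ?R")
  proof
    assume L: ?L
    show ?R
    proof (intro allI impI)
      fix k assume "i < k \<and> k \<le> j"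
      then have "skip_pair p i < skip_pair p k \<and> skip_pair p k \<le> skip_pair p j"
        by (auto simp: skip_pair_def)
      with L have "S i < T (skip_pair p k)" by blast
      then show "S i < S k" by (simp add: T_skip)
    qed
  next
    assume R: ?R
    show ?L
    proof (intro allI impI)
      fix k assume k: "skip_pair p i < k \<and> k \<le> skip_pair p j"
      consider "k \<le> p" | "k = Suc p" | "Suc (Suc p) \<le> k" by linarith
      then show "S i < T k"
      proof cases
        case 1
        then have "i < k \<and> k \<le> j" using k by (auto simp: skip_pair_def split: if_splits)
        with R 1 show ?thesis by (simp add: T)
      next
        case 2
        then have "i < p \<and> p \<le> j" using k by (auto simp: skip_pair_def split: if_splits)
        then have "S i < S p" using R by blast
        with 2 show ?thesis by (simp add: T)
      next
        case 3
        then obtain k' where k': "k = Suc (Suc k')" "p \<le> k'"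
          by (metis Suc_le_D Suc_le_mono)
        then have "i < k' \<and> k' \<le> j" using k by (auto simp: skip_pair_def split: if_splits)
        with R k' show ?thesis by (simp add: T)
      qed
    qed
  qed
  moreover have "skip_pair p i < skip_pair p j \<longleftrightarrow> i < j" by (auto simp: skip_pair_def)
  moreover have "skip_pair p j < length (x @ 1 # -1 # y) \<longleftrightarrow> j < length (x @ y)"
    by (auto simp: skip_pair_def p_def)
  moreover have "set (x @ 1 # -1 # y) \<subseteq> {1, -1}" using assms by auto
  note pairings_iff_height[OF this, of "skip_pair p i" "skip_pair p j", folded T_def]
  ultimately show ?thesis
    unfolding p_def[symmetric] pairings_iff_height[OF assms, folded S_def] by (simp only: T_skip)
qed

text \<open>With \<open>p = length x\<close>, neither of the two inserted positions can be paired with an old one: the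
  letter \<open>1\<close> at \<open>p\<close> opens a pairing that closes at once, and the letter \<open>-1\<close> at \<open>p + 1\<close> leads back
  to the height at \<open>p\<close>, at which an older pairing would have been closed already.\<close>

lemma pairings_insert:
  assumes "set (x @ y) \<subseteq> {1, -1}"
  shows "pairings (x @ 1 # -1 # y) = insert (length x, Suc (length x))
    (map_prod (skip_pair (length x)) (skip_pair (length x)) ` pairings (x @ y))"
    (is "?A = ?B")
proof (intro set_eqI iffI)
  let ?\<alpha> = "x @ 1 # -1 # y" and ?p = "length x"
  define T where "T = height ?\<alpha>"
  have T: "T (Suc ?p) = T ?p + 1" "T (Suc (Suc ?p)) = T ?p"
    by (simp_all add: T_def height_insert)
  have \<alpha>: "set ?\<alpha> \<subseteq> {1, -1}" using assms by auto
  note iff = pairings_iff_height[OF \<alpha>, folded T_def]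
  have cover: "(\<exists>k. k' = skip_pair ?p k) \<or> k' = ?p \<or> k' = Suc ?p" for k'
  proof (cases "k' < ?p")
    case False
    then have "k' = ?p \<or> k' = Suc ?p \<or> k' = skip_pair ?p (k' - 2)" by (auto simp: skip_pair_def)
    then show ?thesis by blast
  qed (auto simp: skip_pair_def)
  {
    fix z assume "z \<in> ?A"
    then obtain i j where z: "z = (i, j)" and ij: "(i, j) \<in> pairings ?\<alpha>" by (cases z) auto
    then have R: "i < j" "T (Suc j) = T i" "\<And>k. i < k \<Longrightarrow> k \<le> j \<Longrightarrow> T i < T k"
      unfolding iff by blast+
    have "i \<noteq> Suc ?p" using R(1) R(3)[of "Suc (Suc ?p)"] T by auto
    moreover have "i = ?p \<Longrightarrow> j = Suc ?p" using R(1) R(3)[of "Suc (Suc ?p)"] T by force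
    moreover have "j \<noteq> ?p" using R(1,2) R(3)[of ?p] T by auto
    moreover have "j = Suc ?p \<Longrightarrow> i = ?p" using R(1,2) R(3)[of ?p] T by force
    ultimately have "(i, j) = (?p, Suc ?p) \<or> (\<exists>i' j'. i = skip_pair ?p i' \<and> j = skip_pair ?p j')"
      using cover[of i] cover[of j] by blast
    then show "z \<in> ?B"
      using ij pairings_insert_skip_pair[OF assms] by (force simp: z)
  next
    fix z assume "z \<in> ?B"
    moreover have "(?p, Suc ?p) \<in> pairings ?\<alpha>"
      unfolding iff using T by (auto simp: le_Suc_eq)
    ultimately show "z \<in> ?A" using pairings_insert_skip_pair[OF assms] by auto
  }
qed

lemma finite_pairings: "finite (pairings \<alpha>)"
  by (rule finite_subset[of _ "{..<length \<alpha>} \<times> {..<length \<alpha>}"]) (auto simp: pairings_def)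

lemma card_pairings_insert:
  assumes "set (x @ y) \<subseteq> {1, -1}"
  shows "card (pairings (x @ 1 # -1 # y)) = Suc (card (pairings (x @ y)))"
proof -
  have "inj (skip_pair (length x))" by (auto simp: inj_on_def skip_pair_def split: if_splits)
  then have "inj (map_prod (skip_pair (length x)) (skip_pair (length x)))" by (simp add: prod.inj_map)
  then have "card (map_prod (skip_pair (length x)) (skip_pair (length x)) ` pairings (x @ y))
      = card (pairings (x @ y))"
    by (meson card_image inj_on_subset subset_UNIV)
  moreover have "(length x, Suc (length x))
      \<notin> map_prod (skip_pair (length x)) (skip_pair (length x)) ` pairings (x @ y)"
    by (auto simp: skip_pair_def split: if_splits)
  ultimately show ?thesis
    unfolding pairings_insert[OF assms] by (simp add: finite_pairings)
qed

lemma compatible_insert: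
  assumes "set (x @ y) \<subseteq> {1, -1}" "length \<gamma> = length x"
  shows "compatible (x @ 1 # -1 # y) (\<gamma> @ b1 # b2 # \<delta>) \<longleftrightarrow> b1 = - b2 \<and> compatible (x @ y) (\<gamma> @ \<delta>)"
proof -
  have "(\<gamma> @ b1 # b2 # \<delta>) ! length x = b1" "(\<gamma> @ b1 # b2 # \<delta>) ! Suc (length x) = b2"
    "\<And>k. (\<gamma> @ b1 # b2 # \<delta>) ! skip_pair (length x) k = (\<gamma> @ \<delta>) ! k"
    using assms(2) nth_insert[of \<gamma> b1 b2 \<delta>] by (auto simp: nth_append)
  then show ?thesis
    unfolding compatible_def pairings_insert[OF assms(1)]
    by (auto simp: map_prod_def split_beta simp del: append_Cons)
qed

section \<open>Reduction of one-factors\<close>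

lemma one_factor_iff_height:
  "one_factor \<alpha> \<longleftrightarrow> set \<alpha> \<subseteq> {1, -1} \<and> (\<forall>k\<le>length \<alpha>. height \<alpha> k \<ge> 0)"
  by (simp add: one_factor_def height_def)

lemma one_factor_remove:
  assumes "one_factor (x @ 1 # -1 # y)" shows "one_factor (x @ y)"
proof -
  have pos: "height (x @ 1 # -1 # y) k \<ge> 0" if "k \<le> length (x @ 1 # -1 # y)" for k
    using assms that unfolding one_factor_iff_height by blast
  have "height (x @ y) k \<ge> 0" if "k \<le> length (x @ y)" for k
  proof (cases "k \<le> length x")
    case True
    then show ?thesis using pos[of k] by (simp add: height_insert)
  next
    case False
    then show ?thesis using pos[of "Suc (Suc k)"] that by (simp add: height_insert)
  qed
  then show ?thesis using assms by (auto simp: one_factor_iff_height)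
qed

text \<open>The neighbours \<open>1, -1\<close> to delete are found at the first entry \<open>-1\<close>: it is not the first
  letter, so that it is preceded by a \<open>1\<close>.\<close>

lemma one_factor_induct [consumes 1, case_names ones peak]:
  assumes "one_factor \<alpha>"
    and ones: "\<And>n. P (replicate n 1)"
    and peak: "\<And>x y. set (x @ y) \<subseteq> {1, -1} \<Longrightarrow> P (x @ y) \<Longrightarrow> P (x @ 1 # -1 # y)"
  shows "P \<alpha>"
  using assms(1)
proof (induction "length \<alpha>" arbitrary: \<alpha> rule: less_induct)
  case less
  show ?case
  proof (cases "-1 \<in> set \<alpha>")
    case False
    then have "\<forall>a\<in>set \<alpha>. a = 1" using less.prems by (auto simp: one_factor_def)
    then have "replicate (length \<alpha>) 1 = \<alpha>" by (rule replicate_length_same)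
    with ones[of "length \<alpha>"] show ?thesis by simp
  next
    case True
    then obtain u y where \<alpha>: "\<alpha> = u @ -1 # y" "-1 \<notin> set u" by (meson split_list_first)
    have "sum_list (take 1 \<alpha>) \<ge> 0" using less.prems \<alpha>(1) by (auto simp: one_factor_def)
    then have "u \<noteq> []" using \<alpha>(1) by auto
    then obtain x where u: "u = x @ [1]"
      using \<alpha> less.prems by (cases u rule: rev_cases) (auto simp: one_factor_def)
    have *: "\<alpha> = x @ 1 # -1 # y" using \<alpha>(1) u by simp
    have of: "one_factor (x @ y)" using less.prems one_factor_remove by (simp add: *)
    moreover have "length (x @ y) < length \<alpha>" by (simp add: *)
    ultimately have "P (x @ y)" by (intro less.hyps)
    moreover have "set (x @ y) \<subseteq> {1, -1}" using of by (simp add: one_factor_def)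
    ultimately show ?thesis unfolding * by (rule peak[rotated])
  qed
qed

lemma pairings_ones: "pairings (replicate n 1) = {}"
proof -
  have "(\<Sum>k=i..j. replicate n (1::int) ! k) = int (Suc j - i)" if "j < n" for i j
    using that by (simp add: sum.cong[where h = "\<lambda>_. 1"])
  then show ?thesis by (auto simp: pairings_def)
qed

text \<open>Every entry \<open>-1\<close> of a one-factor closes a pairing; this turns the hypothesis on the numbers
  of pairings into one on the numbers of entries \<open>-1\<close>, which is visible in the word \<open>\<beta>\<close>.\<close>

lemma card_pairings: "one_factor \<alpha> \<Longrightarrow> card (pairings \<alpha>) = count_list \<alpha> (-1)"
  by (induction \<alpha> rule: one_factor_induct)
     (simp_all add: pairings_ones card_pairings_insert count_notin)

section \<open>The vectors eta\<close>

text \<open>The coordinates of \<open>y\<^sub>1 \<otimes> y\<^sub>-\<^sub>1 - v y\<^sub>-\<^sub>1 \<otimes> y\<^sub>1\<close>.\<close>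

definition cup :: "'k::field \<Rightarrow> int \<Rightarrow> int \<Rightarrow> 'k" where
  "cup v a b = (if a = 1 \<and> b = -1 then 1 else if a = -1 \<and> b = 1 then - v else 0)"

lemma supported_yv: "i = 1 \<or> i = -1 \<Longrightarrow> supported 1 (yv i)"
  by (rule supported_basis_vec) (auto simp: words_def)

lemma tens_yv_Cons:
  fixes b :: "'k::field vec"
  assumes "i = 1 \<or> i = -1" shows "(yv i \<otimes> b) (c # w) = (if c = i then b w else 0)"
proof -
  have "supported (length [c]) (yv i :: 'k vec)" using supported_yv[OF assms] by simp
  from tens_append[OF this, of b w] show ?thesis by (simp add: basis_vec_def[of "[i]"])
qed

lemma Psi_eval: "Psi v b (c # w @ [d]) = cup v c d * b w"
proof -
  have "(yv i \<otimes> b \<otimes> yv k) (c # w @ [d]) = (if c = i \<and> d = k then b w else 0)"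
    if "i = 1 \<or> i = -1" for i k
    unfolding append_Cons[symmetric] tens_yv_snoc tens_yv_Cons[OF that] by simp
  then show ?thesis by (simp add: Psi_def cup_def)
qed

lemma supported_Psi:
  assumes "supported n b" shows "supported (n + 2) (Psi v b)"
proof -
  have "supported (1 + n + 1) (yv i \<otimes> b \<otimes> yv (- i))" if "i = 1 \<or> i = -1" for i
    using that assms by (intro supported_tens supported_yv) auto
  from this[of 1] this[of "-1"] show ?thesis
    by (simp add: Psi_def supported_def) (metis diff_zero mult_zero_right)
qed

lemma pairings_unique: "(i, j) \<in> pairings \<alpha> \<Longrightarrow> (i, j') \<in> pairings \<alpha> \<Longrightarrow> j = j'"
  by (cases j j' rule: linorder_cases) (auto simp: pairings_def)

lemma eta_paired:
  assumes "(0, j) \<in> pairings (a # as)"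
  shows "eta v (a # as) = Psi v (eta v (take (j - 1) as)) \<otimes> eta v (drop j as)"
proof -
  have "(THE j. (0, j) \<in> pairings (a # as)) = j"
    using assms by (blast intro: the_equality pairings_unique)
  then show ?thesis using assms by (auto simp: Let_def)
qed

lemma eta_unpaired:
  "(\<And>j. (0, j) \<notin> pairings (a # as)) \<Longrightarrow> eta v (a # as) = yv 1 \<otimes> eta v as"
  by simp

declare eta.simps(2) [simp del]

lemma pairings_0_bounds: "(0, j) \<in> pairings (a # as) \<Longrightarrow> 0 < j \<and> j \<le> length as"
  by (auto simp: pairings_def)

lemma supported_eta: "supported (length \<alpha>) (eta v \<alpha>)"
proof (induction "length \<alpha>" arbitrary: \<alpha> rule: less_induct)
  case less
  show ?case
  proof (cases \<alpha>)
    case Nil then show ?thesis by (simp add: supported_basis_vec)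
  next
    case (Cons a as)
    show ?thesis
    proof (cases "\<exists>j. (0, j) \<in> pairings (a # as)")
      case True
      then obtain j where j: "(0, j) \<in> pairings (a # as)" ..
      note b = pairings_0_bounds[OF j]
      have "supported (length (take (j - 1) as) + 2 + length (drop j as)) (eta v \<alpha>)"
        unfolding Cons eta_paired[OF j]
        by (intro supported_tens supported_Psi less) (auto simp: Cons)
      moreover have "length (take (j - 1) as) + 2 + length (drop j as) = length \<alpha>"
        using b by (auto simp: Cons)
      ultimately show ?thesis by simp
    next
      case False
      have "supported (1 + length as) (yv 1 \<otimes> eta v as)"
        by (intro supported_tens supported_yv less) (auto simp: Cons)
      then show ?thesis using False by (simp add: Cons eta_unpaired)
    qed
  qed
qed

text \<open>The recursion for \<open>eta\<close> peels off outermost links, whereas the contraction needs an innermost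
  one.  By induction, the inserted link travels down the recursion: the first letter \<open>e\<close> keeps its
  role, and the new pair lies beyond the link of \<open>e\<close> (if the partner \<open>j\<close> of \<open>e\<close> is in \<open>x\<close>) or
  inside it (otherwise), until the new pair comes first.\<close>

lemma eta_insert:
  assumes "set (x @ y) \<subseteq> {1, -1}" "length p = length x" "length q = length y"
  shows "eta v (x @ 1 # -1 # y) (p @ a # b # q) = cup v a b * eta v (x @ y) (p @ q)"
  using assms
proof (induction "length (x @ y)" arbitrary: x y p q rule: less_induct)
  case less
  note ins = pairings_insert[OF less.prems(1)]
  show ?case
  proof (cases x)
    case Nil
    then have "(0, 1) \<in> pairings (1 # -1 # y)" using ins by simp
    note e = eta_paired[OF this]
    have "supported (length [a, b]) (Psi v (eta v []))"
      using supported_Psi[OF supported_eta[of "[]" v], of v] by simp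
    from tens_append[OF this, of "eta v y" q] Psi_eval[of v "eta v []" a "[]" b]
    show ?thesis using Nil less.prems by (simp add: e basis_vec_def)
  next
    case (Cons e x')
    then obtain c p' where p: "p = c # p'" "length p' = length x'"
      using less.prems(2) by (cases p) auto
    let ?L = "e # x' @ 1 # -1 # y" and ?K = "e # x' @ y"
    have skip_pair_0: "skip_pair (length x) i = 0 \<longleftrightarrow> i = 0" for i by (simp add: skip_pair_def Cons)
    have pair: "(0, j) \<in> pairings ?L \<longleftrightarrow> (\<exists>k. j = skip_pair (length x) k \<and> (0, k) \<in> pairings ?K)" for j
    proof -
      have "(0, j) \<in> pairings ?L
          \<longleftrightarrow> (\<exists>(i, k)\<in>pairings ?K. skip_pair (length x) i = 0 \<and> skip_pair (length x) k = j)"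
        unfolding ins[unfolded Cons append_Cons] Cons
        by (rule iffI) (force, force simp: image_iff)
      then show ?thesis unfolding skip_pair_0 by auto
    qed
    show ?thesis
    proof (cases "\<exists>j. (0, j) \<in> pairings ?K")
      case False
      then have "eta v ?L = yv 1 \<otimes> eta v (x' @ 1 # -1 # y)" "eta v ?K = yv 1 \<otimes> eta v (x' @ y)"
        using pair by (auto intro!: eta_unpaired)
      moreover have "eta v (x' @ 1 # -1 # y) (p' @ a # b # q) = cup v a b * eta v (x' @ y) (p' @ q)"
        using less.prems p Cons by (intro less.hyps) auto
      ultimately show ?thesis by (simp add: Cons p tens_yv_Cons)
    next
      case True
      then obtain j where j: "(0, j) \<in> pairings ?K" ..
      note jb = pairings_0_bounds[OF j]
      have j': "(0, skip_pair (length x) j) \<in> pairings ?L" using pair j by blast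
      show ?thesis
      proof (cases "j < length x")
        case True
        let ?P = "Psi v (eta v (take (j - 1) x'))" and ?u = "take (Suc j) p" and ?r = "drop (Suc j) p"
        have le: "j \<le> length x'" using True Cons by simp
        have u: "length (take (j - 1) x') + 2 = length ?u" using le jb p by simp
        have "eta v ?L = ?P \<otimes> eta v (drop j x' @ 1 # -1 # y)"
          using eta_paired[OF j', of v] True le by (simp add: skip_pair_def)
        moreover have "eta v ?K = ?P \<otimes> eta v (drop j x' @ y)"
          using eta_paired[OF j, of v] True le by simp
        moreover have "supported (length ?u) ?P"
          using supported_Psi[OF supported_eta[of "take (j - 1) x'" v], of v] unfolding u .
        note tens_append[OF this]
        moreover have p_split: "p @ z = ?u @ ?r @ z" for z by simp
        moreover have "eta v (drop j x' @ 1 # -1 # y) (?r @ a # b # q)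
            = cup v a b * eta v (drop j x' @ y) (?r @ q)"
          using less.prems p Cons jb by (intro less.hyps) (auto dest: in_set_dropD)
        ultimately show ?thesis
          unfolding Cons append_Cons p_split[of "a # b # q"] p_split[of q] by simp
      next
        case False
        define r where "r = j - 1 - length x'"
        have r: "j = Suc (length x' + r)" "r < length y"
          using False jb by (auto simp: r_def Cons)
        have rq: "r < length q" using r less.prems(3) by simp
        obtain q1 d q2 where q: "q = q1 @ d # q2" "length q1 = r"
          using that[OF id_take_nth_drop[OF rq]] rq by simp
        let ?y1 = "take r y" and ?y2 = "drop (Suc r) y"
        have L: "eta v ?L = Psi v (eta v (x' @ 1 # -1 # ?y1)) \<otimes> eta v ?y2"
          using eta_paired[OF j', of v] False by (simp add: skip_pair_def r numeral_3_eq_3)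
        have L0: "eta v ?K = Psi v (eta v (x' @ ?y1)) \<otimes> eta v ?y2"
          using eta_paired[OF j, of v] by (simp add: r)
        have IH: "eta v (x' @ 1 # -1 # ?y1) (p' @ a # b # q1)
            = cup v a b * eta v (x' @ ?y1) (p' @ q1)"
          using less.prems p Cons r q by (intro less.hyps) (auto dest: in_set_takeD)
        have "supported (length (c # (p' @ a # b # q1) @ [d])) (Psi v (eta v (x' @ 1 # -1 # ?y1)))"
          using supported_Psi[OF supported_eta[of "x' @ 1 # -1 # ?y1" v], of v] p q r by simp
        from tens_append[OF this, of "eta v ?y2" q2]
        have "eta v ?L (p @ a # b # q)
            = cup v c d * eta v (x' @ 1 # -1 # ?y1) (p' @ a # b # q1) * eta v ?y2 q2"
          unfolding L Psi_eval by (simp add: p q)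
        moreover have "supported (length (c # (p' @ q1) @ [d])) (Psi v (eta v (x' @ ?y1)))"
          using supported_Psi[OF supported_eta[of "x' @ ?y1" v], of v] p q r by simp
        from tens_append[OF this, of "eta v ?y2" q2]
        have "eta v ?K (p @ q) = cup v c d * eta v (x' @ ?y1) (p' @ q1) * eta v ?y2 q2"
          unfolding L0 Psi_eval by (simp add: p q)
        ultimately show ?thesis unfolding Cons append_Cons IH by simp
      qed
    qed
  qed
qed

text \<open>Words of length \<open>n + 2\<close> correspond to a word of length \<open>n\<close> and two letters to be inserted
  after its first \<open>k\<close> letters.\<close>

lemma sum_words_insert:
  assumes "k \<le> n"
  shows "(\<Sum>u\<in>words (n + 2). g u)
    = (\<Sum>w\<in>words n. \<Sum>a\<in>{1, -1}. \<Sum>b\<in>{1, -1}. g (take k w @ a # b # drop k w))"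
proof -
  let ?f = "\<lambda>(w, a, b). take k w @ a # b # drop k (w :: int list)"
  let ?D = "words n \<times> {1, -1} \<times> {1, -1 :: int}"
  have len: "length (take k w) = k" if "w \<in> words n" for w
    using that assms by (simp add: length_words)
  have "inj_on ?f ?D"
  proof (rule inj_onI)
    fix z z' assume z: "z \<in> ?D" "z' \<in> ?D" "?f z = ?f z'"
    obtain w a b w' a' b' where zw: "z = (w, a, b)" "z' = (w', a', b')" by (cases z, cases z') auto
    then have "take k w = take k w' \<and> a = a' \<and> b = b' \<and> drop k w = drop k w'"
      using z len[of w] len[of w'] by auto
    moreover from this have "w = w'" by (metis append_take_drop_id)
    ultimately show "z = z'" by (simp add: zw)
  qed
  moreover have "?f ` ?D = words (n + 2)"
  proof (intro equalityI subsetI)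
    fix u assume "u \<in> ?f ` ?D"
    then obtain w a b where w: "w \<in> words n" "a \<in> {1, -1}" "b \<in> {1, -1}"
      and u: "u = take k w @ a # b # drop k w" by auto
    have "set (take k w @ drop k w) \<subseteq> {1, -1}" using w(1) by (simp add: words_def)
    then show "u \<in> words (n + 2)"
      using w assms unfolding set_append by (auto simp: u words_def)
  next
    fix u assume u: "u \<in> words (n + 2)"
    define w where "w = take k u @ drop (k + 2) u"
    have lu: "length u = n + 2" and su: "set u \<subseteq> {1, -1}" using u by (auto simp: words_def)
    have "u = take k u @ u ! k # u ! Suc k # drop (k + 2) u"
      using lu assms by (simp add: Cons_nth_drop_Suc id_take_nth_drop)
    moreover have "w \<in> words n"
      using lu su assms by (auto simp: w_def words_def dest: in_set_takeD in_set_dropD)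
    moreover have "u ! k \<in> set u" "u ! Suc k \<in> set u" using lu assms by auto
    then have "u ! k \<in> {1, -1}" "u ! Suc k \<in> {1, -1}" using su by blast+
    moreover have "take k w = take k u" "drop k w = drop (k + 2) u"
      using lu assms by (auto simp: w_def)
    ultimately show "u \<in> ?f ` ?D" by (intro image_eqI[of _ _ "(w, u ! k, u ! Suc k)"]) auto
  qed
  ultimately have "(\<Sum>u\<in>words (n + 2). g u) = (\<Sum>z\<in>?D. g (?f z))"
    using sum.reindex[of ?f ?D g] by (simp only: o_def)
  also have "\<dots> = (\<Sum>w\<in>words n. \<Sum>a\<in>{1, -1}. \<Sum>b\<in>{1, -1}. g (take k w @ a # b # drop k w))"
    by (simp only: sum.cartesian_product case_prod_unfold fst_conv snd_conv)
  finally show ?thesis .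
qed

lemma form_eta_insert:
  assumes "set (x @ y) \<subseteq> {1, -1}"
  shows "form (length (x @ 1 # -1 # y)) (eta v (x @ 1 # -1 # y)) z
    = form (length (x @ y)) (eta v (x @ y)) (cap v (length x) z)"
proof -
  let ?n = "length (x @ y)" and ?k = "length x"
  have "form (?n + 2) (eta v (x @ 1 # -1 # y)) z
    = (\<Sum>w\<in>words ?n. \<Sum>a\<in>{1, -1}. \<Sum>b\<in>{1, -1}.
         eta v (x @ 1 # -1 # y) (take ?k w @ a # b # drop ?k w) * z (take ?k w @ a # b # drop ?k w))"
    unfolding form_def by (rule sum_words_insert) simp
  also have "\<dots> = (\<Sum>w\<in>words ?n. eta v (x @ y) w * cap v ?k z w)"
  proof (rule sum.cong)
    fix w assume "w \<in> words ?n"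
    then have "eta v (x @ 1 # -1 # y) (take ?k w @ a # b # drop ?k w) = cup v a b * eta v (x @ y) w"
      for a b
      using eta_insert[OF assms, of "take ?k w" "drop ?k w" v a b] by (simp add: length_words)
    then show "(\<Sum>a\<in>{1, -1}. \<Sum>b\<in>{1, -1}.
          eta v (x @ 1 # -1 # y) (take ?k w @ a # b # drop ?k w)
        * z (take ?k w @ a # b # drop ?k w)) = eta v (x @ y) w * cap v ?k z w"
      by (simp add: cup_def cap_def algebra_simps)
  qed simp
  finally show ?thesis by (simp add: form_def)
qed

section \<open>The product of quantum integers\<close>

text \<open>With the value \<open>1\<close> at the entries other than \<open>-1\<close>, the product in the theorem becomes a
  product over all positions, which is easier to split than one over the list of the positions
  of the entries \<open>-1\<close>.\<close>

definition s_factor :: "'k::field \<Rightarrow> int list \<Rightarrow> int list \<Rightarrow> nat \<Rightarrow> 'k" where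
  "s_factor v \<alpha> \<beta> i = (if \<beta> ! i = -1
     then qint v (if \<alpha> ! i = 1 then - height \<beta> i else height \<beta> i + 1) else 1)"

lemma length_neg_positions: "length (neg_positions \<beta>) = count_list \<beta> (-1)"
proof -
  have "count_list \<beta> (-1) = length (filter ((=) (-1)) (map ((!) \<beta>) [0..<length \<beta>]))"
    by (simp only: map_nth count_list_eq_length_filter)
  then show ?thesis by (simp add: neg_positions_def filter_map o_def eq_commute[of _ "-1 :: int"])
qed

lemma prod_s_prime:
  "(\<Prod>j<count_list \<beta> (-1). qint v (s_prime \<alpha> \<beta> j)) = (\<Prod>i<length \<beta>. s_factor v \<alpha> \<beta> i)"
proof -
  let ?N = "neg_positions \<beta>"
  let ?f = "\<lambda>i. qint v (if \<alpha> ! i = 1 then - height \<beta> i else height \<beta> i + 1)"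
  have "(\<Prod>j<count_list \<beta> (-1). qint v (s_prime \<alpha> \<beta> j)) = (\<Prod>j<length ?N. ?f (?N ! j))"
    by (intro prod.cong) (simp_all add: s_prime_def s_val_def height_def length_neg_positions)
  also have "\<dots> = prod_list (map ?f ?N)"
    by (simp add: prod.list_conv_set_nth atLeast0LessThan)
  also have "\<dots> = prod ?f (set ?N)"
    by (rule prod.distinct_set_conv_list[symmetric]) (simp add: neg_positions_def)
  also have "set ?N = {i \<in> {..<length \<beta>}. \<beta> ! i = -1}" by (auto simp: neg_positions_def)
  also have "prod ?f \<dots> = (\<Prod>i<length \<beta>. s_factor v \<alpha> \<beta> i)"
    by (subst prod.inter_filter) (simp_all add: s_factor_def cong: prod.cong)
  finally show ?thesis .
qed

lemma prod_insert_skip_pair: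
  fixes g :: "nat \<Rightarrow> 'k::comm_monoid_mult"
  assumes "p \<le> n"
  shows "(\<Prod>i<n + 2. g i) = g p * g (Suc p) * (\<Prod>i<n. g (skip_pair p i))"
  using assms
proof (induction n rule: dec_induct)
  case base then show ?case by (simp add: skip_pair_def mult_ac)
next
  case (step n) then show ?case by (simp add: skip_pair_def mult_ac)
qed

text \<open>Deleting neighbours with sum \<open>0\<close> leaves the heights of \<open>\<beta>\<close> at the other positions
  unchanged, so only the two factors at the deleted positions are lost.\<close>

lemma prod_s_factor_insert:
  assumes "length \<gamma> = length x" "b1 + b2 = 0"
  shows "(\<Prod>i<length (\<gamma> @ b1 # b2 # \<delta>). s_factor v (x @ 1 # -1 # y) (\<gamma> @ b1 # b2 # \<delta>) i)
    = (if b1 = -1 then qint v (- sum_list \<gamma>) else 1)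
      * (if b2 = -1 then qint v (sum_list \<gamma> + b1 + 1) else 1)
      * (\<Prod>i<length (\<gamma> @ \<delta>). s_factor v (x @ y) (\<gamma> @ \<delta>) i)"
proof -
  let ?\<alpha> = "x @ 1 # -1 # y" and ?\<beta> = "\<gamma> @ b1 # b2 # \<delta>" and ?p = "length x"
  have "height ?\<beta> (skip_pair ?p i) = height (\<gamma> @ \<delta>) i" for i
    using assms by (auto simp: skip_pair_def height_insert)
  then have "s_factor v ?\<alpha> ?\<beta> (skip_pair ?p i) = s_factor v (x @ y) (\<gamma> @ \<delta>) i" for i
    using nth_insert[of x 1 "-1" y i] nth_insert[of \<gamma> b1 b2 \<delta> i]
    by (simp only: s_factor_def assms(1))
  moreover have "length ?\<beta> = length (\<gamma> @ \<delta>) + 2" by simp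
  moreover have "s_factor v ?\<alpha> ?\<beta> ?p = (if b1 = -1 then qint v (- sum_list \<gamma>) else 1)"
    "s_factor v ?\<alpha> ?\<beta> (Suc ?p) = (if b2 = -1 then qint v (sum_list \<gamma> + b1 + 1) else 1)"
    using assms(1) by (auto simp: s_factor_def nth_append height_def)
  ultimately show ?thesis
    using prod_insert_skip_pair[of ?p "length (\<gamma> @ \<delta>)" "s_factor v ?\<alpha> ?\<beta>"] assms(1) by simp
qed

section \<open>The formula\<close>

lemma eta_ones: "eta v (replicate n 1) = basis_vec (replicate n 1)"
proof (induction n)
  case (Suc n)
  have "yv 1 \<otimes> basis_vec (replicate n 1) = basis_vec (replicate (Suc n) (1::int))"
  proof
    fix w :: "int list"
    show "(yv 1 \<otimes> basis_vec (replicate n 1)) w = basis_vec (replicate (Suc n) 1) w"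
    proof (cases w)
      case Nil then show ?thesis by (simp add: tens_def basis_vec_def)
    next
      case (Cons c u) then show ?thesis by (simp only: tens_yv_Cons simp_thms) (simp add: basis_vec_def)
    qed
  qed
  moreover have "(0, j) \<notin> pairings (1 # replicate n 1)" for j
    using pairings_ones[of "Suc n"] by simp
  ultimately show ?case using Suc by (simp add: eta_unpaired)
qed simp

lemma mu_ones: "mu v (replicate n 1) = basis_vec (replicate n 1)"
proof (induction n)
  case (Suc n)
  have "Phi1 (basis_vec (replicate n 1)) = basis_vec (replicate n 1 @ [1])"
  proof
    fix w
    show "Phi1 (basis_vec (replicate n 1)) w = basis_vec (replicate n 1 @ [1]) w"
    proof (cases w rule: rev_cases)
      case Nil then show ?thesis by (simp add: Phi1_def tens_def basis_vec_def)
    next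
      case (snoc u c) then show ?thesis by (simp add: Phi1_snoc) (simp add: basis_vec_def)
    qed
  qed
  then show ?case using Suc by (simp add: mu_snoc flip: replicate_append_same)
qed (simp add: mu_Nil)

text \<open>The induction deletes the positions of neighbours \<open>1, -1\<close> of \<open>\<alpha>\<close> from \<open>\<beta>\<close>, where the
  entries may be \<open>1, -1\<close> or \<open>-1, 1\<close>.  What is carried along for \<open>\<beta>\<close> is the number of its
  entries \<open>-1\<close>: it is what forces \<open>\<beta> = \<alpha>\<close> at the end.\<close>

lemma form_eta_mu:
  fixes v :: "'k::field"
  assumes "v \<noteq> 0" "one_factor \<alpha>"
    and "set \<beta> \<subseteq> {1, -1}" "length \<beta> = length \<alpha>" "count_list \<beta> (-1) = count_list \<alpha> (-1)"
  shows "form (length \<alpha>) (eta v \<alpha>) (mu v \<beta>)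
    = (if compatible \<alpha> \<beta> then v ^ count_list \<alpha> (-1) * (\<Prod>i<length \<beta>. s_factor v \<alpha> \<beta> i) else 0)"
  using assms(2-)
proof (induction \<alpha> arbitrary: \<beta> rule: one_factor_induct)
  case (ones n)
  then have "-1 \<notin> set \<beta>" by (simp add: count_notin count_list_0_iff)
  then have "\<forall>b\<in>set \<beta>. b = 1" using ones.prems by auto
  then have \<beta>: "\<beta> = replicate n 1" using ones.prems by (metis length_replicate replicate_length_same)
  have u: "replicate n 1 \<in> words n" by (auto simp: words_def)
  have "form n (basis_vec (replicate n 1)) (basis_vec (replicate n 1))
      = (\<Sum>w\<in>words n. if w = replicate n 1 then 1 else 0 :: 'k)"
    unfolding form_def by (rule sum.cong) (auto simp: basis_vec_def)
  then have "form n (basis_vec (replicate n 1)) (basis_vec (replicate n 1)) = (1 :: 'k)"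
    using u by simp
  moreover have "compatible (replicate n 1) \<beta>" by (simp add: compatible_def pairings_ones)
  ultimately show ?case
    by (simp add: \<beta> eta_ones mu_ones count_notin s_factor_def)
next
  case (peak x y)
  define \<gamma> where "\<gamma> = take (length x) \<beta>"
  obtain b1 b2 \<delta> where "drop (length x) \<beta> = b1 # b2 # \<delta>"
  proof -
    have "length (drop (length x) \<beta>) = Suc (Suc (length y))" using peak.prems(2) by simp
    with that show ?thesis unfolding length_Suc_conv by blast
  qed
  then have \<beta>: "\<beta> = \<gamma> @ b1 # b2 # \<delta>" unfolding \<gamma>_def by (metis append_take_drop_id)
  have len: "length \<gamma> = length x" using peak.prems(2) by (simp add: \<gamma>_def)
  have b: "b1 = 1 \<or> b1 = -1" "b2 = 1 \<or> b2 = -1" using peak.prems(1) by (auto simp: \<beta>)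
  let ?c = "if b1 = b2 then 0 else v * qint v (if b1 = 1 then sum_list \<gamma> + 2 else - sum_list \<gamma>)"
  have step: "form (length (x @ 1 # -1 # y)) (eta v (x @ 1 # -1 # y)) (mu v \<beta>)
      = ?c * form (length (x @ y)) (eta v (x @ y)) (mu v (\<gamma> @ \<delta>))"
    using cap_mu[OF assms(1), of \<gamma> b1 b2 \<delta>] peak.prems(1) unfolding form_eta_insert[OF peak.hyps]
    by (simp add: \<beta> len form_def sum_distrib_left mult_ac)
  show ?case
  proof (cases "b1 = b2")
    case True
    then have "\<not> compatible (x @ 1 # -1 # y) \<beta>"
      using b compatible_insert[OF peak.hyps len] by (auto simp: \<beta>)
    with True show ?thesis unfolding step by simp
  next
    case False
    then have opp: "b1 = - b2" "b1 + b2 = 0" using b by auto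
    have IH: "form (length (x @ y)) (eta v (x @ y)) (mu v (\<gamma> @ \<delta>))
      = (if compatible (x @ y) (\<gamma> @ \<delta>)
         then v ^ count_list (x @ y) (-1) * (\<Prod>i<length (\<gamma> @ \<delta>). s_factor v (x @ y) (\<gamma> @ \<delta>) i) else 0)"
      using peak.prems b opp by (intro peak.IH) (auto simp: \<beta> len)
    have prod: "v ^ count_list (x @ 1 # -1 # y) (-1) * (\<Prod>i<length \<beta>. s_factor v (x @ 1 # -1 # y) \<beta> i)
      = ?c * (v ^ count_list (x @ y) (-1) * (\<Prod>i<length (\<gamma> @ \<delta>). s_factor v (x @ y) (\<gamma> @ \<delta>) i))"
      unfolding \<beta> prod_s_factor_insert[OF len opp(2)] using b False
      by (auto simp: mult_ac add.commute[of 2])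
    have "compatible (x @ 1 # -1 # y) \<beta> \<longleftrightarrow> compatible (x @ y) (\<gamma> @ \<delta>)"
      unfolding \<beta> compatible_insert[OF peak.hyps len] using opp(1) by simp
    then show ?thesis unfolding step IH prod by simp
  qed
qed

theorem theorem5p5:
  fixes v :: "'k::field" and n m :: nat and \<alpha> \<beta> :: "int list"
  assumes "v \<noteq> 0" and "qfact v n \<noteq> 0"
    and "one_factor \<alpha>" and "one_factor \<beta>"
    and "length \<alpha> = length \<beta>" and "length \<alpha> \<le> n"
    and "card (pairings \<alpha>) = m" and "card (pairings \<beta>) = m"
  shows "form (length \<alpha>) (eta v \<alpha>) (mu v \<beta>)
           = (if compatible \<alpha> \<beta> then v ^ m * (\<Prod>j<m. qint v (s_prime \<alpha> \<beta> j)) else 0)"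
proof -
  have m: "count_list \<alpha> (-1) = m" "count_list \<beta> (-1) = m"
    using assms(3,4,7,8) by (simp_all add: card_pairings)
  have "set \<beta> \<subseteq> {1, -1}" using assms(4) by (simp add: one_factor_def)
  then show ?thesis
    using form_eta_mu[OF assms(1,3), of \<beta>] assms(5) m prod_s_prime[of v \<alpha> \<beta>] by simp
qed

end
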